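(* Let $\mathcal{S}$ be a set, let $O\in\mathcal{S}$, and let $\Omega\subseteq\mathcal{S}_{\rm nc}$ be a nonempty set closed under direct sums of matrices. Suppose that for every $n\in\operatorname{supp}\Omega$, $\Omega_n$ is a complete metric space with respect to a metric $\rho_n$. Let $$\Omega^j=\coprod_{n\in\operatorname{supp}\Omega}\Omega^j_n\subseteq\Omega,\quad \Omega^j_n\subseteq\Omega_n,\quad j=1,2,\ldots,$$ be a sequence of sets such that: (i) $\Omega^j$ is closed under direct sums of matrices, for every $j=1,2,\ldots$; (ii) $\Omega^j_n$ is a non-empty closed subset of $\Omega_n$, for every $n\in\operatorname{supp}\Omega$ and $j=1,2,\ldots$; (iii) $\Omega^1\supseteq\Omega^2\supseteq\cdots$; (iv) $\operatorname{diam}\Omega^j_n:=\sup_{X,Y\in\Omega^j_n}\rho_n(X,Y)\to0$ as $j\to\infty$, for every $n\in\operatorname{supp}\Omega$. Then there exists a unique $X_*\in\mathcal{S}^{d\times d}$, with $d=\gcd\{n\colon n\in\operatorname{supp}\Omega\}$, such that $$\bigcap_{j=1}^\infty\Omega^j=\left\{\bigoplus_{\alpha=1}^{n/d}X_*\right\}_{n\in\operatorname{supp}\Omega}.$$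
   Context: For a set $\mathcal{S}$, $\mathcal{S}^{n\times n}$ is the set of $n\times n$ matrices (arrays) with entries in $\mathcal{S}$, with no algebraic structure assumed, and $\mathcal{S}_{\rm nc}:=\coprod_{n=1}^\infty\mathcal{S}^{n\times n}$. For $\Omega\subseteq\mathcal{S}_{\rm nc}$ write $\Omega_n:=\Omega\cap\mathcal{S}^{n\times n}$ and $\operatorname{supp}\Omega:=\{n\in\mathbb{N}\colon\Omega_n\neq\emptyset\}$, where $\mathbb{N}=\{1,2,\dots\}$. With a fixed element $O\in\mathcal{S}$, the direct sum of $X\in\mathcal{S}^{n\times n}$ and $Y\in\mathcal{S}^{m\times m}$ is the block matrix $X\oplus Y:=\begin{bmatrix}X&\mathbf{O}_{n\times m}\\ \mathbf{O}_{m\times n}&Y\end{bmatrix}\in\mathcal{S}^{(n+m)\times(n+m)}$, where $\mathbf{O}_{p\times q}$ is the $p\times q$ matrix all of whose entries equal $O$. $\bigoplus_{\alpha=1}^kX$ is the direct sum of $k$ copies of $X$. $\Omega$ is closed under (respects) direct sums if $X\in\Omega_n$, $Y\in\Omega_m$ imply $X\oplus Y\in\Omega_{n+m}$. *)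

theory Defs
  imports
    "HOL-Analysis.Abstract_Metric_Spaces"
    "HOL-Library.Extended_Real"
    "Jordan_Normal_Form.Matrix"
begin

definition sq_mats :: "'a set \<Rightarrow> nat \<Rightarrow> 'a mat set" where
  "sq_mats S n = {X \<in> carrier_mat n n. elements_mat X \<subseteq> S}"

text \<open>Matrices carry their dimensions, so the disjoint union over all sizes is an ordinary union.\<close>

definition nc_space :: "'a set \<Rightarrow> 'a mat set" where
  "nc_space S = (\<Union>n\<in>{1..}. sq_mats S n)"

definition nc_level :: "'a mat set \<Rightarrow> nat \<Rightarrow> 'a mat set" where
  "nc_level \<Omega> n = \<Omega> \<inter> carrier_mat n n"

definition nc_supp :: "'a mat set \<Rightarrow> nat set" where
  "nc_supp \<Omega> = {n. 1 \<le> n \<and> nc_level \<Omega> n \<noteq> {}}"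

text \<open>The first argument is the element of \<open>S\<close> that fills the off-diagonal blocks.\<close>

definition dsum :: "'a \<Rightarrow> 'a mat \<Rightarrow> 'a mat \<Rightarrow> 'a mat" where
  "dsum e X Y = four_block_mat
     X (mat (dim_row X) (dim_col Y) (\<lambda>_. e))
     (mat (dim_row Y) (dim_col X) (\<lambda>_. e)) Y"

text \<open>The empty matrix is a neutral element for \<^const>\<open>dsum\<close>, so one copy of \<open>X\<close> is \<open>X\<close> itself.\<close>

primrec dsum_copies :: "'a \<Rightarrow> nat \<Rightarrow> 'a mat \<Rightarrow> 'a mat" where
  "dsum_copies e 0 X = mat 0 0 (\<lambda>_. e)"
| "dsum_copies e (Suc k) X = dsum e X (dsum_copies e k X)"

lemma dsum_copies_one: "dsum_copies e 1 X = X"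
  by (auto simp: dsum_def four_block_mat_def Let_def intro!: eq_matI)

definition closed_dsum :: "'a \<Rightarrow> 'a mat set \<Rightarrow> bool" where
  "closed_dsum e \<Omega> \<longleftrightarrow>
     (\<forall>n\<ge>1. \<forall>m\<ge>1. \<forall>X\<in>nc_level \<Omega> n. \<forall>Y\<in>nc_level \<Omega> m. dsum e X Y \<in> nc_level \<Omega> (n + m))"

text \<open>The diameter is extended real, as unbounded sets are allowed.\<close>

definition mdiam :: "'b metric \<Rightarrow> 'b set \<Rightarrow> ereal" where
  "mdiam \<rho> A = (SUP (x, y)\<in>A \<times> A. ereal (mdist \<rho> x y))"

end

theory Submission
  imports Defs
begin

text \<open>
  Cantor's intersection theorem, applied level by level, shows that the intersection contains
  exactly one matrix \<open>X\<^sub>n\<close> of each size \<open>n\<close> in the support, and closedness under direct sums gives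
  \<open>X\<^sub>n \<oplus> X\<^sub>m = X\<^sub>n\<^sub>+\<^sub>m = X\<^sub>m \<oplus> X\<^sub>n\<close>. Hence all \<open>X\<^sub>n\<close> are upper left corners of one infinite matrix
  \<open>F\<close>, and each \<open>n\<close> in the support is a block period of \<open>F\<close>: \<open>F\<close> is block diagonal with equal
  \<open>n \<times> n\<close> blocks. Block periods are closed under sums and differences, so the gcd \<open>d\<close> of
  the support is one too, and \<open>X\<^sub>*\<close> is the \<open>d \<times> d\<close> corner of \<open>F\<close>.
\<close>

section \<open>Greatest common divisors in sets of naturals closed under sums and
  differences\<close>

text \<open>Division with remainder by the least positive element \<open>p\<close> of
  \<open>G\<close> shows that \<open>G\<close> consists of multiples of \<open>p\<close>. So
  \<open>p\<close> divides \<open>Gcd A\<close>, and multiples of \<open>p\<close> lie in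
  \<open>G\<close>. If \<open>A\<close> has no positive element, the gcd is 0.\<close>

lemma Gcd_mem_if_closed_add_diff:
  fixes G A :: "nat set"
  assumes "A \<subseteq> G" and zero: "0 \<in> G"
    and add: "\<And>p q. p \<in> G \<Longrightarrow> q \<in> G \<Longrightarrow> p + q \<in> G"
    and diff: "\<And>p q. p \<in> G \<Longrightarrow> q \<in> G \<Longrightarrow> p - q \<in> G"
  shows "Gcd A \<in> G"
proof (cases "A \<subseteq> {0}")
  case True
  then have "Gcd A = 0" by simp
  then show ?thesis using zero by (simp only:)
next
  case False
  have mult: "k * p \<in> G" if "p \<in> G" for k p
    by (induction k) (use zero that add in auto)
  define p where "p = (LEAST p. p \<in> G \<and> 0 < p)"
  have "\<exists>p. p \<in> G \<and> 0 < p"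
    using False \<open>A \<subseteq> G\<close> by auto
  then have p: "p \<in> G" "0 < p"
    unfolding p_def by (metis (mono_tags, lifting) LeastI_ex)+
  have "p dvd g" if "g \<in> G" for g
  proof -
    have "g mod p \<in> G"
      using diff[OF that mult[OF p(1), of "g div p"]] by (simp add: minus_div_mult_eq_mod)
    moreover have "g mod p < p" using p by simp
    ultimately show ?thesis
      using not_less_Least[of "g mod p" "\<lambda>p. p \<in> G \<and> 0 < p"] unfolding p_def by auto
  qed
  then have "p dvd Gcd A"
    using \<open>A \<subseteq> G\<close> by (blast intro: Gcd_greatest)
  then show ?thesis
    using mult[OF p(1)] by (metis dvdE mult.commute)
qed

section \<open>Entries of corners and direct sums\<close>

lemma elements_mat_corner:
  assumes "d \<le> n"
  shows "elements_mat (mat d d F) \<subseteq> elements_mat (mat n n F)"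
proof
  fix a
  assume "a \<in> elements_mat (mat d d F)"
  then obtain i j where "i < d" "j < d" "a = F (i, j)"
    by (auto dest: elements_matD)
  then show "a \<in> elements_mat (mat n n F)"
    using assms by (intro elements_matI[of _ n n i j]) auto
qed

lemma dim_dsum [simp]:
  "dim_row (dsum e X Y) = dim_row X + dim_row Y"
  "dim_col (dsum e X Y) = dim_col X + dim_col Y"
  by (simp_all add: dsum_def)

lemma index_dsum:
  assumes "X \<in> carrier_mat n n" "Y \<in> carrier_mat m m" "i < n + m" "j < n + m"
  shows "dsum e X Y $$ (i, j) =
    (if i < n \<and> j < n then X $$ (i, j)
     else if n \<le> i \<and> n \<le> j then Y $$ (i - n, j - n) else e)"
  using assms by (auto simp: dsum_def)

lemma dsum_copies_carrier:
  "X \<in> carrier_mat d d \<Longrightarrow> dsum_copies e k X \<in> carrier_mat (k * d) (k * d)"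
  by (induction k) auto

text \<open>The upper left \<open>d\<close> by \<open>d\<close> block of a sum of
  \<open>k > 0\<close> copies is the summand itself. This gives the uniqueness of the diagonal
  block.\<close>

lemma dsum_copies_inject:
  assumes X: "X \<in> carrier_mat d d" and Y: "Y \<in> carrier_mat d d" and "0 < k"
    and eq: "dsum_copies e k X = dsum_copies e k Y"
  shows "X = Y"
proof (rule eq_matI)
  obtain l where l: "k = Suc l" using \<open>0 < k\<close> gr0_conv_Suc by blast
  fix i j
  assume "i < dim_row Y" "j < dim_col Y"
  then have ij: "i < d" "j < d" using Y by auto
  show "X $$ (i, j) = Y $$ (i, j)"
    using arg_cong[OF eq, of "\<lambda>Z. Z $$ (i, j)"] ij
      index_dsum[OF X dsum_copies_carrier[OF X, of e l], of i j e]
      index_dsum[OF Y dsum_copies_carrier[OF Y, of e l], of i j e]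
    by (simp add: l)
qed (use X Y in auto)

section \<open>Block periods of an infinite matrix\<close>

text \<open>Indices start at 0, so \<open>mat n n F\<close> is the upper left corner of size
  \<open>n\<close>. The second condition clears only the first block row and column; the shift
  carries it along the diagonal to all blocks.\<close>

definition block_period :: "'a \<Rightarrow> (nat \<times> nat \<Rightarrow> 'a) \<Rightarrow> nat \<Rightarrow> bool" where
  "block_period e F p \<longleftrightarrow>
     (\<forall>i j. F (i + p, j + p) = F (i, j)) \<and>
     (\<forall>i j. i < p \<and> p \<le> j \<longrightarrow> F (i, j) = e \<and> F (j, i) = e)"

lemma block_period_shift: "block_period e F p \<Longrightarrow> F (i + p, j + p) = F (i, j)"
  by (simp add: block_period_def)

lemma block_period_off_diagonal:
  "block_period e F p \<Longrightarrow> i < p \<Longrightarrow> p \<le> j \<Longrightarrow> F (i, j) = e \<and> F (j, i) = e"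
  by (simp add: block_period_def)

lemma block_period_0: "block_period e F 0"
  by (simp add: block_period_def)

lemma block_period_add:
  assumes p: "block_period e F p" and q: "block_period e F q"
  shows "block_period e F (p + q)"
  unfolding block_period_def
proof (intro conjI[of "\<forall>i j. _ i j"] allI impI)
  fix i j
  show "F (i + (p + q), j + (p + q)) = F (i, j)"
    using block_period_shift[OF p, of i j] block_period_shift[OF q, of "i + p" "j + p"]
    by (simp add: add.assoc)
next
  fix i j
  assume ij: "i < p + q \<and> p + q \<le> j"
  show "F (i, j) = e \<and> F (j, i) = e"
  proof (cases "i < p")
    case True
    then show ?thesis using block_period_off_diagonal[OF p, of i j] ij by simp
  next
    \<comment> \<open>Now \<open>p \<le> i < p + q\<close>: shifting back by \<open>p\<close> moves
      the entry into the first \<open>q\<close> rows and past the first \<open>q\<close> columns (or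
      the transpose of this).\<close>
    case False
    then show ?thesis
      using block_period_off_diagonal[OF q, of "i - p" "j - p"] ij
        block_period_shift[OF p, of "i - p" "j - p"] block_period_shift[OF p, of "j - p" "i - p"]
      by auto
  qed
qed

text \<open>Shifting by \<open>p - q\<close> and then by \<open>q\<close> is shifting by
  \<open>p\<close>. For the zeros, adding \<open>q\<close> to both indices turns
  \<open>i < p - q \<le> j\<close> into \<open>i + q < p \<le> j + q\<close>. If
  \<open>p < q\<close>, the truncated difference is the trivial period 0.\<close>

lemma block_period_diff:
  assumes p: "block_period e F p" and q: "block_period e F q"
  shows "block_period e F (p - q)"
proof (cases "q \<le> p")
  case True
  show ?thesis
    unfolding block_period_def
  proof (intro conjI[of "\<forall>i j. _ i j"] allI impI)
    fix i j
    show "F (i + (p - q), j + (p - q)) = F (i, j)"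
      using block_period_shift[OF p, of i j] True
        block_period_shift[OF q, of "i + (p - q)" "j + (p - q)"]
      by simp
  next
    fix i j
    assume "i < p - q \<and> p - q \<le> j"
    then show "F (i, j) = e \<and> F (j, i) = e"
      using block_period_off_diagonal[OF p, of "i + q" "j + q"]
        block_period_shift[OF q, of i j] block_period_shift[OF q, of j i]
      by auto
  qed
qed (simp add: block_period_0)

lemma block_period_Gcd:
  assumes "\<And>n. n \<in> A \<Longrightarrow> block_period e F n"
  shows "block_period e F (Gcd A)"
  using Gcd_mem_if_closed_add_diff[of A "Collect (block_period e F)"] assms
  by (auto intro: block_period_0 block_period_add block_period_diff)

text \<open>The lower right block of the larger corner is the \<open>q\<close> by \<open>q\<close>
  corner shifted by \<open>p\<close>. Leaving \<open>q\<close> arbitrary makes this the induction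
  step for sums of copies.\<close>

lemma dsum_block_period:
  assumes "block_period e F p"
  shows "dsum e (mat p p F) (mat q q F) = mat (p + q) (p + q) F"
proof (rule eq_matI)
  fix i j
  assume "i < dim_row (mat (p + q) (p + q) F)" "j < dim_col (mat (p + q) (p + q) F)"
  then have ij: "i < p + q" "j < p + q" by auto
  show "dsum e (mat p p F) (mat q q F) $$ (i, j) = mat (p + q) (p + q) F $$ (i, j)"
    using ij block_period_shift[OF assms, of "i - p" "j - p"]
      block_period_off_diagonal[OF assms, of i j] block_period_off_diagonal[OF assms, of j i]
    by (auto simp: index_dsum[of _ p _ q])
qed auto

lemma dsum_copies_block_period:
  "block_period e F d \<Longrightarrow> dsum_copies e k (mat d d F) = mat (k * d) (k * d) F"
  by (induction k) (auto simp: dsum_block_period)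

text \<open>Each entry of \<open>F\<close> is read off any \<open>X n\<close> large enough to
  contain it. The period \<open>n\<close> is then visible in \<open>X (n + m)\<close>, which is
  \<open>X n\<close> followed by \<open>X m\<close>.\<close>

lemma ex_block_periodic_matrix:
  assumes "N \<noteq> {}" and pos: "\<And>n. n \<in> N \<Longrightarrow> 1 \<le> n"
    and add: "\<And>n m. n \<in> N \<Longrightarrow> m \<in> N \<Longrightarrow> n + m \<in> N"
    and X: "\<And>n. n \<in> N \<Longrightarrow> X n \<in> carrier_mat n n"
    and dsum_X: "\<And>n m. n \<in> N \<Longrightarrow> m \<in> N \<Longrightarrow> dsum e (X n) (X m) = X (n + m)"
  obtains F where "\<And>n. n \<in> N \<Longrightarrow> block_period e F n" "\<And>n. n \<in> N \<Longrightarrow> X n = mat n n F"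
proof -
  obtain n\<^sub>0 where n\<^sub>0: "n\<^sub>0 \<in> N" using \<open>N \<noteq> {}\<close> by blast
  have mult: "Suc k * n\<^sub>0 \<in> N" for k
    by (induction k) (use n\<^sub>0 add in auto)
  have large: "\<exists>n\<in>N. i < n \<and> j < n" for i j
  proof -
    have "Suc (max i j) * 1 \<le> Suc (max i j) * n\<^sub>0"
      by (rule mult_le_mono2) (rule pos[OF n\<^sub>0])
    then show ?thesis using mult[of "max i j"] by (intro bexI[of _ "Suc (max i j) * n\<^sub>0"]) auto
  qed
  define r where "r i j = (SOME n. n \<in> N \<and> i < n \<and> j < n)" for i j
  have r: "r i j \<in> N" "i < r i j" "j < r i j" for i j
    using someI_ex[of "\<lambda>n. n \<in> N \<and> i < n \<and> j < n"] large[of i j] unfolding r_def by blast+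
  define F where "F = (\<lambda>(i, j). X (r i j) $$ (i, j))"
  have sum_left: "X (n + m) $$ (i, j) = X n $$ (i, j)"
    if "n \<in> N" "m \<in> N" "i < n" "j < n" for n m i j
    using index_dsum[OF X[OF that(1)] X[OF that(2)], of i j e] dsum_X[OF that(1,2)] that
    by simp
  \<comment> \<open>The size \<open>r i j\<close> chosen does not matter: \<open>X n\<close> and
    \<open>X (r i j)\<close> are both upper left corners of \<open>X (n + r i j)\<close>, as
    addition commutes.\<close>
  have F: "F (i, j) = X n $$ (i, j)" if "n \<in> N" "i < n" "j < n" for n i j
    using sum_left[of n "r i j" i j] sum_left[of "r i j" n i j] r(1,2)[of i j] r(3)[of j i] that
    by (simp add: F_def add.commute)
  have "block_period e F n" if n: "n \<in> N" for n
    unfolding block_period_def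
  proof (intro conjI[of "\<forall>i j. _ i j"] allI impI)
    fix i j
    obtain m where m: "m \<in> N" "i < m" "j < m" using large by blast
    show "F (i + n, j + n) = F (i, j)"
      using index_dsum[OF X[OF n] X[OF m(1)], of "i + n" "j + n" e] dsum_X[OF n m(1)]
        F[OF add[OF n m(1)], of "i + n" "j + n"] F[OF m] m
      by simp
  next
    fix i j
    assume ij: "i < n \<and> n \<le> j"
    obtain m where m: "m \<in> N" "i < m" "j < m" using large by blast
    show "F (i, j) = e \<and> F (j, i) = e"
      using index_dsum[OF X[OF n] X[OF m(1)], of i j e] index_dsum[OF X[OF n] X[OF m(1)], of j i e]
        dsum_X[OF n m(1)] F[OF add[OF n m(1)], of i j] F[OF add[OF n m(1)], of j i] m ij
      by simp
  qed
  moreover have "X n = mat n n F" if "n \<in> N" for n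
    using X[OF that] F[OF that] by (intro eq_matI) auto
  ultimately show ?thesis by (rule that)
qed

section \<open>Cantor's intersection theorem in terms of diameters\<close>

lemma Cantor_intersection_mdiam:
  assumes "mcomplete_of m"
    and closed: "\<And>j. closedin (mtopology_of m) (C j)"
    and nonempty: "\<And>j. C j \<noteq> {}"
    and "decseq C"
    and diam: "(\<lambda>j. mdiam m (C j)) \<longlonglongrightarrow> 0"
  obtains x where "(\<Inter>j. C j) = {x}"
proof -
  interpret Metric_space "mspace m" "mdist m" by (rule Metric_space_mspace_mdist)
  \<comment> \<open>\<open>mcomplete_nest_sing\<close> asks for members inside arbitrarily small
    balls; a set of diameter below \<open>\<epsilon>\<close> lies in the ball around any of its
    points.\<close>
  have "\<exists>j a. C j \<subseteq> mcball a \<epsilon>" if "0 < \<epsilon>" for \<epsilon>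
  proof -
    have "\<forall>\<^sub>F j in sequentially. mdiam m (C j) < ereal \<epsilon>"
      using order_tendstoD(2)[OF diam, of "ereal \<epsilon>"] that by simp
    then obtain j where j: "mdiam m (C j) < ereal \<epsilon>"
      by (auto simp: eventually_sequentially)
    obtain a where a: "a \<in> C j" using nonempty by blast
    have "mdist m a x \<le> \<epsilon>" if "x \<in> C j" for x
    proof -
      have "ereal (mdist m a x) \<le> mdiam m (C j)"
        unfolding mdiam_def using a that by (intro SUP_upper2[of "(a, x)"]) auto
      then have "ereal (mdist m a x) < ereal \<epsilon>"
        using j by (rule le_less_trans)
      then show ?thesis by simp
    qed
    moreover have "C j \<subseteq> mspace m"
      using closedin_subset[OF closed[of j]] by simp
    ultimately have "C j \<subseteq> mcball a \<epsilon>"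
      using a by (auto simp: in_mcball)
    then show ?thesis by blast
  qed
  then have "\<exists>l. l \<in> mspace m \<and> \<Inter> (range C) = {l}"
    using assms mcomplete_nest_sing by (auto simp: mcomplete_of_def mtopology_of_def)
  then show ?thesis using that by blast
qed

section \<open>The points of the intersection and their common diagonal block\<close>

theorem theorem14:
  fixes S :: "'a set" and e :: 'a
    and \<Omega> :: "'a mat set"
    and \<rho> :: "nat \<Rightarrow> 'a mat metric"
    and \<Omega>s :: "nat \<Rightarrow> 'a mat set"
  assumes "e \<in> S"
    and "\<Omega> \<subseteq> nc_space S" and "\<Omega> \<noteq> {}" and "closed_dsum e \<Omega>"
    and "\<And>n. n \<in> nc_supp \<Omega> \<Longrightarrow> mspace (\<rho> n) = nc_level \<Omega> n \<and> mcomplete_of (\<rho> n)"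
    and "\<And>j. j \<ge> 1 \<Longrightarrow> \<Omega>s j \<subseteq> \<Omega>"
    and "\<And>j. j \<ge> 1 \<Longrightarrow> closed_dsum e (\<Omega>s j)"
    and "\<And>n j. n \<in> nc_supp \<Omega> \<Longrightarrow> j \<ge> 1 \<Longrightarrow>
           nc_level (\<Omega>s j) n \<noteq> {} \<and> closedin (mtopology_of (\<rho> n)) (nc_level (\<Omega>s j) n)"
    and "\<And>j. j \<ge> 1 \<Longrightarrow> \<Omega>s (Suc j) \<subseteq> \<Omega>s j"
    and "\<And>n. n \<in> nc_supp \<Omega> \<Longrightarrow> (\<lambda>j. mdiam (\<rho> n) (nc_level (\<Omega>s j) n)) \<longlonglongrightarrow> 0"
  shows "let d = Gcd (nc_supp \<Omega>) in
           \<exists>!X. X \<in> sq_mats S d \<and>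
             (\<Inter>j\<in>{1..}. \<Omega>s j) = {dsum_copies e (n div d) X | n. n \<in> nc_supp \<Omega>}"
proof -
  define N where "N = nc_supp \<Omega>"
  define d where "d = Gcd N"
  define I where "I = (\<Inter>j\<in>{1..}. \<Omega>s j)"
  have pos: "1 \<le> n" if "n \<in> N" for n
    using that by (simp add: N_def nc_supp_def)
  obtain Y\<^sub>0 where Y\<^sub>0: "Y\<^sub>0 \<in> \<Omega>" using assms(3) by blast
  then obtain n\<^sub>0 where "1 \<le> n\<^sub>0" "Y\<^sub>0 \<in> carrier_mat n\<^sub>0 n\<^sub>0"
    using assms(2) by (auto simp: nc_space_def sq_mats_def)
  then have n\<^sub>0: "n\<^sub>0 \<in> N"
    using Y\<^sub>0 by (auto simp: N_def nc_supp_def nc_level_def)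
  have d_dvd: "d dvd n" if "n \<in> N" for n
    using that by (simp add: d_def)
  have add: "n + m \<in> N" if "n \<in> N" "m \<in> N" for n m
  proof -
    obtain Y Z where "Y \<in> nc_level \<Omega> n" "Z \<in> nc_level \<Omega> m"
      using \<open>n \<in> N\<close> \<open>m \<in> N\<close> by (auto simp: N_def nc_supp_def)
    then have "dsum e Y Z \<in> nc_level \<Omega> (n + m)"
      using assms(4) pos[OF \<open>n \<in> N\<close>] pos[OF \<open>m \<in> N\<close>] by (simp add: closed_dsum_def)
    then show ?thesis
      using pos[OF \<open>n \<in> N\<close>] by (auto simp: N_def nc_supp_def)
  qed
  have "\<exists>x. I \<inter> carrier_mat n n = {x}" if "n \<in> N" for n
  proof -
    have n: "n \<in> nc_supp \<Omega>" using that by (simp add: N_def)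
    \<comment> \<open>The sets are numbered from 1, so the sequence passed to Cantor's theorem is
      shifted by \<open>Suc\<close>.\<close>
    obtain x where x: "(\<Inter>j. nc_level (\<Omega>s (Suc j)) n) = {x}"
    proof (rule Cantor_intersection_mdiam[of "\<rho> n" "\<lambda>j. nc_level (\<Omega>s (Suc j)) n"])
      show "decseq (\<lambda>j. nc_level (\<Omega>s (Suc j)) n)"
        using assms(9) by (intro decseq_SucI) (force simp: nc_level_def)
      show "(\<lambda>j. mdiam (\<rho> n) (nc_level (\<Omega>s (Suc j)) n)) \<longlonglongrightarrow> 0"
        using assms(10)[OF n] by (rule LIMSEQ_Suc)
    qed (use assms(5,8) n in auto)
    moreover have "{1..} = range Suc"
      using Suc_le_D by (fastforce simp: image_iff)
    then have "I \<inter> carrier_mat n n = (\<Inter>j. nc_level (\<Omega>s (Suc j)) n)"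
      by (auto simp: I_def nc_level_def)
    ultimately show ?thesis by auto
  qed
  then obtain X where X: "\<And>n. n \<in> N \<Longrightarrow> I \<inter> carrier_mat n n = {X n}"
    by metis
  \<comment> \<open>The direct sum lies in every \<open>\<Omega>s j\<close> with
    \<open>j \<ge> 1\<close>, hence in \<open>I\<close>, whose only matrix of size
    \<open>n + m\<close> is \<open>X (n + m)\<close>.\<close>
  have dsum_X: "dsum e (X n) (X m) = X (n + m)" if nm: "n \<in> N" "m \<in> N" for n m
  proof -
    have "X n \<in> I \<inter> carrier_mat n n" "X m \<in> I \<inter> carrier_mat m m"
      using X nm by auto
    then have "dsum e (X n) (X m) \<in> I \<inter> carrier_mat (n + m) (n + m)"
      using assms(7) pos[OF nm(1)] pos[OF nm(2)] by (simp add: I_def closed_dsum_def nc_level_def)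
    then show ?thesis using X[OF add[OF nm]] by simp
  qed
  obtain F where F: "\<And>n. n \<in> N \<Longrightarrow> block_period e F n" "\<And>n. n \<in> N \<Longrightarrow> X n = mat n n F"
  proof (rule ex_block_periodic_matrix[of N X e])
    show "N \<noteq> {}" using n\<^sub>0 by blast
    show "X n \<in> carrier_mat n n" if "n \<in> N" for n using X[OF that] by blast
  qed (use pos add dsum_X in auto)
  \<comment> \<open>By closure under gcd, \<open>d\<close> is a block period of \<open>F\<close>, so
    \<open>n div d\<close> copies of its \<open>d\<close> by \<open>d\<close> corner fill the corner
    of size \<open>n\<close>, which is \<open>X n\<close>.\<close>
  have copies: "dsum_copies e (n div d) (mat d d F) = X n" if "n \<in> N" for n
    using dsum_copies_block_period[OF block_period_Gcd[of N e F, folded d_def], of "n div d"]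
      F d_dvd[OF that] that by simp
  have subset: "I \<subseteq> nc_space S"
    using assms(2) assms(6)[of 1] by (auto simp: I_def)
  have I_eq: "I = {dsum_copies e (n div d) (mat d d F) | n. n \<in> N}"
  proof (intro equalityI subsetI)
    fix Y
    assume Y: "Y \<in> I"
    then obtain n where n: "1 \<le> n" "Y \<in> carrier_mat n n"
      using subset by (auto simp: nc_space_def sq_mats_def)
    moreover have "Y \<in> \<Omega>"
      using Y assms(6)[of 1] by (auto simp: I_def)
    ultimately have "n \<in> N" by (auto simp: N_def nc_supp_def nc_level_def)
    then have "Y \<in> {X n}"
      unfolding X[OF \<open>n \<in> N\<close>, symmetric] using Y n(2) by simp
    then have "Y = dsum_copies e (n div d) (mat d d F)"
      using copies[OF \<open>n \<in> N\<close>] by simp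
    then show "Y \<in> {dsum_copies e (n div d) (mat d d F) | n. n \<in> N}"
      using \<open>n \<in> N\<close> by (intro CollectI exI conjI)
  next
    fix Y
    assume "Y \<in> {dsum_copies e (n div d) (mat d d F) | n. n \<in> N}"
    then show "Y \<in> I" using X copies by auto
  qed
  \<comment> \<open>Since \<open>d \<le> n\<^sub>0\<close>, the entries of this corner occur in
    \<open>X n\<^sub>0\<close>, whose entries lie in \<open>S\<close>.\<close>
  have corner: "mat d d F \<in> sq_mats S d"
  proof -
    have "X n\<^sub>0 \<in> I" "X n\<^sub>0 \<in> carrier_mat n\<^sub>0 n\<^sub>0" using X[OF n\<^sub>0] by auto
    then have "elements_mat (X n\<^sub>0) \<subseteq> S"
      using subset by (auto simp: nc_space_def sq_mats_def)
    moreover have "d \<le> n\<^sub>0"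
      using d_dvd[OF n\<^sub>0] pos[OF n\<^sub>0] by (simp add: dvd_imp_le)
    then have "elements_mat (mat d d F) \<subseteq> elements_mat (X n\<^sub>0)"
      unfolding F(2)[OF n\<^sub>0] by (rule elements_mat_corner)
    ultimately show ?thesis by (auto simp: sq_mats_def)
  qed
  \<comment> \<open>One size suffices: \<open>I\<close> has a single matrix of size
    \<open>n\<^sub>0\<close>, so the sums of \<open>n\<^sub>0 div d > 0\<close> copies of both
    candidates coincide.\<close>
  have unique: "Y = mat d d F"
    if Y: "Y \<in> sq_mats S d" and eq: "I = {dsum_copies e (n div d) Y | n. n \<in> N}" for Y
  proof -
    have carrier: "Y \<in> carrier_mat d d" using Y by (simp add: sq_mats_def)
    have "dsum_copies e (n\<^sub>0 div d) Y \<in> I" using eq n\<^sub>0 by blast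
    moreover have "dsum_copies e (n\<^sub>0 div d) Y \<in> carrier_mat n\<^sub>0 n\<^sub>0"
      using dsum_copies_carrier[OF carrier, of e "n\<^sub>0 div d"] d_dvd[OF n\<^sub>0] by simp
    ultimately have "dsum_copies e (n\<^sub>0 div d) Y = dsum_copies e (n\<^sub>0 div d) (mat d d F)"
      using X[OF n\<^sub>0] copies[OF n\<^sub>0] by auto
    moreover have "0 < n\<^sub>0 div d"
      using d_dvd[OF n\<^sub>0] pos[OF n\<^sub>0] by auto
    ultimately show ?thesis using dsum_copies_inject[OF carrier, of "mat d d F"] by auto
  qed
  show ?thesis
    unfolding Let_def N_def[symmetric] d_def[symmetric] I_def[symmetric]
    by (rule ex1I[of _ "mat d d F"], rule conjI[OF corner I_eq], elim conjE, rule unique)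
qed

end
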